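(* Let $(W,S)$ be a Coxeter group with $k=|S|$, and assume that the corresponding Coxeter diagram has at least one edge. Let $\mu^{max}(W,S)\in(0,k]$ be the maximal eigenvalue of the non-normalized Laplacian on the Coxeter diagram. Then the curvature function of the Cayley graph $G=\mathrm{Cay}(W,S)$ is given, for $\mathcal N\in(0,\infty]$, by $$\mathcal K_G(\mathcal N)=\begin{cases}2-\frac{2k}{\mathcal N},&\text{if }\mathcal N\le\mathcal N_0,\\[1mm]2-\mu^{max}(W,S),&\text{if }\mathcal N>\mathcal N_0,\end{cases}\qquad\text{with }\mathcal N_0=\frac{2k}{\mu^{max}(W,S)}.$$
   Context: For a locally finite simple graph $G=(V,E)$ and $f:V\to\mathbb R$ put $\Delta f(x)=\sum_{y\sim x}(f(y)-f(x))$ (non-normalized Laplacian), and for $f,g:V\to\mathbb R$ put $2\Gamma(f,g)=\Delta(fg)-f\Delta g-g\Delta f$, $2\Gamma_2(f,g)=\Delta\Gamma(f,g)-\Gamma(f,\Delta g)-\Gamma(\Delta f,g)$, $\Gamma(f)=\Gamma(f,f)$, $\Gamma_2(f)=\Gamma_2(f,f)$. For $\mathcal N\in(0,\infty]$ (convention $1/\infty=0$), $\mathcal K_{G,x}(\mathcal N)$ is the largest $K\in\mathbb R$ such that $\Gamma_2(f)(x)\ge\frac1{\mathcal N}(\Delta f(x))^2+K\,\Gamma(f)(x)$ for all $f:V\to\mathbb R$ (Bakry-Émery curvature function). A Coxeter group $(W,S)$ is a group $W$ with finite generating set $S=\{s_1,\dots,s_k\}$ and presentation $W=\langle S\mid(s_is_j)^{m(i,j)}\rangle$,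 where $m(i,j)=m(j,i)$, $m(i,i)=1$, and $m(i,j)\in\{2,3,\dots\}\cup\{\infty\}$ for $i\ne j$ ($m(i,j)=\infty$ means there is no relation between $s_i$ and $s_j$). Its Coxeter diagram is the simple unweighted graph with vertices $1,\dots,k$, where $i\neq j$ are joined by an edge iff $m(i,j)\ge3$ (including $m(i,j)=\infty$). Eigenvalues of the non-normalized Laplacian of a finite graph are taken with the sign making them non-negative (i.e. eigenvalues of $D-A$ with $D$ the degree matrix and $A$ the adjacency matrix). The Cayley graph $\mathrm{Cay}(W,S)$ has vertex set $W$, with $g$ adjacent to $gs$ for $g\in W$, $s\in S$ (each generator, being an involution, gives a single edge at every vertex). It is vertex transitive, so its curvature function does not depend on the vertex; $\mathcal K_G$ denotes this common function. *)

theory Defs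
  imports
    "HOL-Library.Extended_Nat"
    "HOL-Library.Extended_Real"
    "HOL-Algebra.Generated_Groups"
    "Jordan_Normal_Form.Spectral_Radius"
begin

section \<open>Bakry-Emery curvature of a locally finite simple graph\<close>

text \<open>
  A simple graph is given by its symmetric and irreflexive adjacency relation \<open>E\<close>.  Functions
  on the vertex set are total functions on the type; the operators below, evaluated at a vertex
  \<open>x\<close>, only see the values of \<open>f\<close> at \<open>x\<close> and at vertices reachable from it.
\<close>

definition laplacian :: "('v \<Rightarrow> 'v \<Rightarrow> bool) \<Rightarrow> ('v \<Rightarrow> real) \<Rightarrow> 'v \<Rightarrow> real" where
  "laplacian E f = (\<lambda>x. \<Sum>y | E x y. f y - f x)"

definition Gamma :: "('v \<Rightarrow> 'v \<Rightarrow> bool) \<Rightarrow> ('v \<Rightarrow> real) \<Rightarrow> ('v \<Rightarrow> real) \<Rightarrow> 'v \<Rightarrow> real" where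
  "Gamma E f g = (\<lambda>x. (laplacian E (\<lambda>z. f z * g z) x
                        - f x * laplacian E g x - g x * laplacian E f x) / 2)"

definition Gamma2 :: "('v \<Rightarrow> 'v \<Rightarrow> bool) \<Rightarrow> ('v \<Rightarrow> real) \<Rightarrow> ('v \<Rightarrow> real) \<Rightarrow> 'v \<Rightarrow> real" where
  "Gamma2 E f g = (\<lambda>x. (laplacian E (Gamma E f g) x
                         - Gamma E f (laplacian E g) x - Gamma E (laplacian E f) g x) / 2)"

text \<open>
  The dimension parameter \<open>N\<close> ranges over the positive extended reals; \<open>1 / \<infinity> = 0\<close> holds in
  \<^typ>\<open>ereal\<close>.
\<close>

definition curvature_dimension ::
    "('v \<Rightarrow> 'v \<Rightarrow> bool) \<Rightarrow> 'v \<Rightarrow> real \<Rightarrow> ereal \<Rightarrow> bool" where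
  "curvature_dimension E x K N \<longleftrightarrow>
     (\<forall>f. Gamma2 E f f x \<ge> real_of_ereal (1 / N) * (laplacian E f x)\<^sup>2 + K * Gamma E f f x)"

definition curvature_function :: "('v \<Rightarrow> 'v \<Rightarrow> bool) \<Rightarrow> 'v \<Rightarrow> ereal \<Rightarrow> real" where
  "curvature_function E x N = (GREATEST K. curvature_dimension E x K N)"


section \<open>Group presentations\<close>

text \<open>
  Words in letters \<open>(i, True)\<close>, standing for the generator with index \<open>i\<close>, and \<open>(i, False)\<close>,
  standing for its formal inverse.
\<close>

type_synonym 'i group_word = "('i \<times> bool) list"

text \<open>
  Equality in the group presented by generators indexed by \<open>I\<close> and relators \<open>R\<close>: the congruence
  on words generated by free cancellation and the relators.
\<close>

inductive presented_eq :: "'i set \<Rightarrow> 'i group_word set \<Rightarrow> 'i group_word \<Rightarrow> 'i group_word \<Rightarrow> bool"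
  for I R where
  refl: "u \<in> lists (I \<times> UNIV) \<Longrightarrow> presented_eq I R u u"
| sym: "presented_eq I R u v \<Longrightarrow> presented_eq I R v u"
| trans: "presented_eq I R u v \<Longrightarrow> presented_eq I R v w \<Longrightarrow> presented_eq I R u w"
| cancel: "u \<in> lists (I \<times> UNIV) \<Longrightarrow> v \<in> lists (I \<times> UNIV) \<Longrightarrow> i \<in> I \<Longrightarrow>
    presented_eq I R (u @ [(i, b), (i, \<not> b)] @ v) (u @ v)"
| relator: "u \<in> lists (I \<times> UNIV) \<Longrightarrow> v \<in> lists (I \<times> UNIV) \<Longrightarrow> r \<in> R \<Longrightarrow>
    presented_eq I R (u @ r @ v) (u @ v)"

definition word_value :: "('a, 'b) monoid_scheme \<Rightarrow> ('i \<Rightarrow> 'a) \<Rightarrow> 'i group_word \<Rightarrow> 'a" where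
  "word_value G s w =
     foldr (\<lambda>(i, b) g. (if b then s i else inv\<^bsub>G\<^esub> (s i)) \<otimes>\<^bsub>G\<^esub> g) w \<one>\<^bsub>G\<^esub>"

text \<open>The assignment \<open>i \<mapsto> s i\<close> induces an isomorphism from the presented group onto \<open>G\<close>.\<close>

definition has_presentation ::
    "('a, 'b) monoid_scheme \<Rightarrow> ('i \<Rightarrow> 'a) \<Rightarrow> 'i set \<Rightarrow> 'i group_word set \<Rightarrow> bool" where
  "has_presentation G s I R \<longleftrightarrow>
     group G \<and> s ` I \<subseteq> carrier G \<and> generate G (s ` I) = carrier G \<and> R \<subseteq> lists (I \<times> UNIV) \<and>
     (\<forall>u\<in>lists (I \<times> UNIV). \<forall>v\<in>lists (I \<times> UNIV).
        word_value G s u = word_value G s v \<longleftrightarrow> presented_eq I R u v)"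


section \<open>Coxeter groups, their diagrams and Cayley graphs\<close>

text \<open>The generators are indexed by \<open>{..<k}\<close>, so that they match the rows of a matrix.\<close>

definition coxeter_matrix :: "nat \<Rightarrow> (nat \<Rightarrow> nat \<Rightarrow> enat) \<Rightarrow> bool" where
  "coxeter_matrix k m \<longleftrightarrow>
     (\<forall>i<k. m i i = 1) \<and> (\<forall>i<k. \<forall>j<k. m i j = m j i) \<and> (\<forall>i<k. \<forall>j<k. i \<noteq> j \<longrightarrow> 2 \<le> m i j)"

definition coxeter_relators :: "nat \<Rightarrow> (nat \<Rightarrow> nat \<Rightarrow> enat) \<Rightarrow> nat group_word set" where
  "coxeter_relators k m =
     {concat (replicate n [(i, True), (j, True)]) | i j n. i < k \<and> j < k \<and> m i j = enat n}"

text \<open>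
  Distinctness of the generators expresses that the generating set \<open>{s 0, \<dots>, s (k - 1)}\<close> has
  \<open>k\<close> elements.
\<close>

definition coxeter_group ::
    "('a, 'b) monoid_scheme \<Rightarrow> nat \<Rightarrow> (nat \<Rightarrow> 'a) \<Rightarrow> (nat \<Rightarrow> nat \<Rightarrow> enat) \<Rightarrow> bool" where
  "coxeter_group W k s m \<longleftrightarrow>
     coxeter_matrix k m \<and> inj_on s {..<k} \<and> has_presentation W s {..<k} (coxeter_relators k m)"

definition coxeter_diagram :: "nat \<Rightarrow> (nat \<Rightarrow> nat \<Rightarrow> enat) \<Rightarrow> nat \<Rightarrow> nat \<Rightarrow> bool" where
  "coxeter_diagram k m i j \<longleftrightarrow> i < k \<and> j < k \<and> i \<noteq> j \<and> 3 \<le> m i j"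

definition cayley_graph :: "('a, 'b) monoid_scheme \<Rightarrow> 'a set \<Rightarrow> 'a \<Rightarrow> 'a \<Rightarrow> bool" where
  "cayley_graph G S g h \<longleftrightarrow> g \<in> carrier G \<and> (\<exists>t\<in>S. h = g \<otimes>\<^bsub>G\<^esub> t)"


section \<open>Laplacian matrix of a graph on \<open>{..<n}\<close>\<close>

definition adjacency_matrix :: "nat \<Rightarrow> (nat \<Rightarrow> nat \<Rightarrow> bool) \<Rightarrow> real mat" where
  "adjacency_matrix n E = mat n n (\<lambda>(i, j). if E i j then 1 else 0)"

definition degree_matrix :: "nat \<Rightarrow> (nat \<Rightarrow> nat \<Rightarrow> bool) \<Rightarrow> real mat" where
  "degree_matrix n E = mat_diag n (\<lambda>i. real (card {j. j < n \<and> E i j}))"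

definition max_laplacian_eigenvalue :: "nat \<Rightarrow> (nat \<Rightarrow> nat \<Rightarrow> bool) \<Rightarrow> real" where
  "max_laplacian_eigenvalue n E = Max (spectrum (degree_matrix n E - adjacency_matrix n E))"

end

theory Submission
  imports Defs "HOL-Analysis.Function_Topology"
begin

text \<open>
  Write \<open>d\<^sub>i = f (x s\<^sub>i) - f x\<close>.  Completing squares in the values of \<open>f\<close> on the sphere of radius 2
  gives \<open>\<Gamma>\<^sub>2(f)(x) \<ge> \<bar>d\<bar>\<^sup>2 - Q(d) / 2\<close>, where \<open>Q\<close> is the Dirichlet form of the Coxeter diagram: a
  commuting pair \<open>i, j\<close> contributes 0 and a non-commuting one \<open>- (d\<^sub>i - d\<^sub>j)\<^sup>2 / 2\<close>.  Equality is
  attained for every \<open>d\<close>, because the elements \<open>x s\<^sub>i s\<^sub>j\<close> coincide only as forced by commutation,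
  which is read off the geometric representation.  Since \<open>2 \<Gamma>(f)(x) = \<bar>d\<bar>\<^sup>2\<close>, the curvature is 2
  minus the largest eigenvalue of the diagram Laplacian plus \<open>2 / N\<close> times the all-ones matrix.
  The constant vector and its orthogonal complement are invariant, so that eigenvalue is
  \<open>max \<mu> (2 k / N)\<close>.
\<close>


section \<open>The largest eigenvalue of a graph Laplacian as a Rayleigh quotient\<close>

text \<open>For small \<open>t\<close> the linear term dominates the quadratic one. This serves as
  the first-order condition at a maximum.\<close>

lemma quadratic_nonneg_linear_coeff:
  fixes b c :: real
  assumes "\<And>t. 0 \<le> 2 * t * b + t\<^sup>2 * c"
  shows "b = 0"
proof (rule ccontr)
  assume b: "b \<noteq> 0"
  \<comment> \<open>Any positive \<open>D\<close> with \<open>c < 2 * D\<close> would do: at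
    \<open>t = - b / D\<close> the expression equals
    \<open>(b / D)\<^sup>2 * (c - 2 * D)\<close>.\<close>
  define D where "D = \<bar>c\<bar> + 1"
  have D: "D > 0" "c < 2 * D" unfolding D_def by auto
  have "0 \<le> 2 * (- b / D) * b + (- b / D)\<^sup>2 * c" by (rule assms)
  also have "\<dots> = (b / D)\<^sup>2 * (c - 2 * D)"
    using D by (simp add: field_simps power2_eq_square)
  also have "\<dots> < 0" using b D by (intro mult_pos_neg) auto
  finally show False by simp
qed

text \<open>The form attains its maximum on the compact unit sphere, homogeneity extends the bound
  to all vectors, and the first variation at a maximizer is the eigenvector equation.\<close>

lemma symmetric_form_maximizer:
  fixes A :: "nat \<Rightarrow> nat \<Rightarrow> real"
  assumes sym: "\<And>i j. i < n \<Longrightarrow> j < n \<Longrightarrow> A i j = A j i" and "0 < n"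
  obtains v l where "(\<Sum>i<n. (v i)\<^sup>2) = 1"
    and "\<And>d. (\<Sum>i<n. \<Sum>j<n. A i j * d i * d j) \<le> l * (\<Sum>i<n. (d i)\<^sup>2)"
    and "\<And>i. i < n \<Longrightarrow> (\<Sum>j<n. A i j * v j) = l * v i"
proof -
  define q where "q = (\<lambda>d :: nat \<Rightarrow> real. \<Sum>i<n. \<Sum>j<n. A i j * d i * d j)"
  \<comment> \<open>Vectors are functions on all of \<open>nat\<close>, so the coordinates from
    \<open>n\<close> on are frozen at 0; the box is then compact in the product topology, and
    \<open>K\<close> is a copy of the unit sphere.\<close>
  define box :: "(nat \<Rightarrow> real) set" where
    "box = (\<Pi>\<^sub>E i\<in>UNIV. if i < n then {-1..1} else {0})"
  define K where "K = box \<inter> {d. (\<Sum>i<n. (d i)\<^sup>2) = 1}"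
  have "compact box"
    unfolding box_def compactin_euclidean_iff[symmetric] euclidean_product_topology[symmetric]
    by (subst compactin_PiE) auto
  moreover have "closed {d :: nat \<Rightarrow> real. (\<Sum>i<n. (d i)\<^sup>2) = 1}"
    by (intro closed_Collect_eq continuous_intros) auto
  ultimately have "compact K" unfolding K_def by (rule compact_Int_closed)
  moreover have "(\<lambda>i. if i = 0 then 1 else 0) \<in> K"
    using \<open>0 < n\<close> by (auto simp: K_def box_def if_distrib[of "\<lambda>x. x\<^sup>2"] cong: if_cong)
  moreover have "continuous_on K q"
    unfolding q_def
    by (intro continuous_intros continuous_on_subset[OF continuous_on_product_coordinates]) auto
  ultimately obtain v where v: "v \<in> K" and vmax: "\<And>d. d \<in> K \<Longrightarrow> q d \<le> q v"
    using continuous_attains_sup[of K q] by blast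
  have v1: "(\<Sum>i<n. (v i)\<^sup>2) = 1" using v unfolding K_def by simp
  have le: "q d \<le> q v * (\<Sum>i<n. (d i)\<^sup>2)" for d
  proof (cases "(\<Sum>i<n. (d i)\<^sup>2) = 0")
    case True
    then have "d i = 0" if "i < n" for i
      using that by (simp add: sum_nonneg_eq_0_iff)
    then show ?thesis using True by (simp add: q_def)
  next
    case False
    define S where "S = (\<Sum>i<n. (d i)\<^sup>2)"
    have S: "S > 0" using False unfolding S_def by (simp add: sum_nonneg order.not_eq_order_implies_strict)
    define e where "e = (\<lambda>i. if i < n then d i / sqrt S else 0)"
    have e1: "(\<Sum>i<n. (e i)\<^sup>2) = 1"
      using S by (simp add: e_def power_divide S_def flip: sum_divide_distrib)
    have "- 1 \<le> e i \<and> e i \<le> 1" if "i < n" for i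
    proof -
      have "(e i)\<^sup>2 \<le> (\<Sum>i<n. (e i)\<^sup>2)" using that by (intro member_le_sum) auto
      then have "\<bar>e i\<bar> \<le> 1" using e1 by (simp add: abs_square_le_1)
      then show ?thesis by linarith
    qed
    moreover have "e i = 0" if "\<not> i < n" for i using that by (simp add: e_def)
    ultimately have "e \<in> box" by (auto simp: box_def)
    then have "q e \<le> q v" using e1 by (intro vmax) (simp add: K_def)
    moreover have "q e = q d / S"
      using S by (simp add: q_def e_def sum_divide_distrib)
    ultimately show ?thesis using S by (simp add: field_simps S_def)
  qed
  have "(\<Sum>j<n. A i j * v j) = q v * v i" if i: "i < n" for i
  proof -
    define w where "w = (\<lambda>j. if j = i then 1 else 0 :: real)"
    have w: "(\<Sum>j<n. g j * w j) = g i" for g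
      using i by (simp add: w_def if_distrib[of "\<lambda>x. _ * x"] cong: if_cong)
    have cross: "(\<Sum>j<n. \<Sum>h<n. A j h * (v j + t * w j) * (v h + t * w h))
        = q v + 2 * t * (\<Sum>j<n. A i j * v j) + t\<^sup>2 * A i i" for t
    proof -
      have "(\<Sum>j<n. \<Sum>h<n. A j h * (v j + t * w j) * (v h + t * w h))
        = q v + (\<Sum>j<n. \<Sum>h<n. A j h * v h * w j) * t + (\<Sum>j<n. \<Sum>h<n. A j h * v j * w h) * t
          + (\<Sum>j<n. \<Sum>h<n. A j h * w j * w h) * t\<^sup>2"
        unfolding q_def sum_distrib_right sum.distrib[symmetric]
        by (intro sum.cong) (auto simp: power2_eq_square algebra_simps)
      also have "(\<Sum>j<n. \<Sum>h<n. A j h * v h * w j) = (\<Sum>h<n. A i h * v h)"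
        using i by (subst sum.swap) (simp add: w)
      also have "(\<Sum>j<n. \<Sum>h<n. A j h * v j * w h) = (\<Sum>h<n. A h i * v h)"
        using i by (simp add: w)
      also have "\<dots> = (\<Sum>h<n. A i h * v h)"
        using i sym by (intro sum.cong) auto
      also have "(\<Sum>j<n. \<Sum>h<n. A j h * w j * w h) = A i i"
        using i by (simp add: w)
      finally show ?thesis by (simp add: algebra_simps)
    qed
    have sq: "(\<Sum>j<n. (v j + t * w j)\<^sup>2) = 1 + 2 * t * v i + t\<^sup>2" for t
    proof -
      have "(\<Sum>j<n. (v j + t * w j)\<^sup>2) = (\<Sum>j<n. (v j)\<^sup>2 + (2 * t * v j + t\<^sup>2) * w j)"
        by (intro sum.cong) (auto simp: w_def power2_eq_square algebra_simps)
      also have "\<dots> = 1 + 2 * t * v i + t\<^sup>2"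
        by (simp add: sum.distrib v1 w)
      finally show ?thesis .
    qed
    \<comment> \<open>The bound \<open>le\<close> at the perturbation of \<open>v\<close> in
      direction \<open>w\<close>; its constant terms cancel, and the coefficient of \<open>t\<close>
      must vanish.\<close>
    have "0 \<le> 2 * t * (q v * v i - (\<Sum>j<n. A i j * v j)) + t\<^sup>2 * (q v - A i i)" for t
      using le[of "\<lambda>j. v j + t * w j"] cross[of t] unfolding sq
      by (simp add: q_def algebra_simps)
    then show ?thesis using quadratic_nonneg_linear_coeff by fastforce
  qed
  then show ?thesis using that[OF v1] le unfolding q_def by blast
qed

section \<open>The Dirichlet form and the spectrum of the Laplacian matrix\<close>

text \<open>For symmetric \<open>E\<close> the factor 1/2 compensates for meeting each edge in both
  orders.\<close>

definition dirichlet_form :: "nat \<Rightarrow> (nat \<Rightarrow> nat \<Rightarrow> bool) \<Rightarrow> (nat \<Rightarrow> real) \<Rightarrow> real" where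
  "dirichlet_form n E d = (\<Sum>i<n. \<Sum>j<n. if E i j then (d i - d j)\<^sup>2 / 2 else 0)"

lemma laplacian_matrix_mult_vec:
  assumes "i < n" "\<not> E i i"
  shows "((degree_matrix n E - adjacency_matrix n E) *\<^sub>v vec n d) $ i
    = (\<Sum>j<n. if E i j then d i - d j else 0)"
proof -
  have "((degree_matrix n E - adjacency_matrix n E) *\<^sub>v vec n d) $ i
      = (\<Sum>j<n. (if i = j then real (card {j. j < n \<and> E i j}) * d j else 0)
           - (if E i j then d j else 0))"
    using assms
    by (auto simp: degree_matrix_def adjacency_matrix_def mat_diag_def mult_mat_vec_def
      scalar_prod_def atLeast0LessThan left_diff_distrib intro!: sum.cong)
  also have "\<dots> = real (card {j. j < n \<and> E i j}) * d i - (\<Sum>j<n. if E i j then d j else 0)"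
    using assms by (simp add: sum_subtractf)
  also have "real (card {j. j < n \<and> E i j}) * d i = (\<Sum>j<n. if E i j then d i else 0)"
    by (simp add: sum.If_cases Int_def lessThan_def)
  also have "\<dots> - (\<Sum>j<n. if E i j then d j else 0) = (\<Sum>j<n. if E i j then d i - d j else 0)"
    by (subst sum_subtractf[symmetric]) (intro sum.cong, auto)
  finally show ?thesis .
qed

context
  fixes n :: nat and E :: "nat \<Rightarrow> nat \<Rightarrow> bool"
  assumes E_sym: "\<And>i j. E i j \<Longrightarrow> E j i" and E_irrefl: "\<And>i. \<not> E i i"
begin

text \<open>Summation by parts: exchanging \<open>i\<close> and \<open>j\<close> shows that both
  halves of the expanded square contribute equally.\<close>

lemma dirichlet_form_eq_inner:
  "dirichlet_form n E d = (\<Sum>i<n. d i * (\<Sum>j<n. if E i j then d i - d j else 0))"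
proof -
  have "(\<Sum>i<n. \<Sum>j<n. if E i j then d i * (d i - d j) else 0)
      = (\<Sum>i<n. \<Sum>j<n. if E i j then d j * (d j - d i) else 0)" (is "?S = ?T")
    by (subst sum.swap) (use E_sym in \<open>auto intro!: sum.cong\<close>)
  moreover have "2 * dirichlet_form n E d = ?S + ?T"
    unfolding dirichlet_form_def sum_distrib_left sum.distrib[symmetric]
    by (intro sum.cong) (auto simp: power2_eq_square field_simps)
  moreover have "?S = (\<Sum>i<n. d i * (\<Sum>j<n. if E i j then d i - d j else 0))"
    by (auto simp: sum_distrib_left intro!: sum.cong)
  ultimately show ?thesis by simp
qed

lemma eigenvalue_laplacian_matrix_iff:
  "eigenvalue (degree_matrix n E - adjacency_matrix n E) l \<longleftrightarrow>
    (\<exists>d. (\<exists>i<n. d i \<noteq> 0) \<and> (\<forall>i<n. (\<Sum>j<n. if E i j then d i - d j else 0) = l * d i))"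
  (is "eigenvalue ?L l \<longleftrightarrow> ?R")
proof
  have dim: "dim_row ?L = n" "dim_row (adjacency_matrix n E) = n"
    by (simp_all add: adjacency_matrix_def)
  {
    assume "eigenvalue ?L l"
    then obtain v where v: "v \<in> carrier_vec n" "v \<noteq> 0\<^sub>v n" "?L *\<^sub>v v = l \<cdot>\<^sub>v v"
      unfolding eigenvalue_def eigenvector_def dim(1) by blast
    have vec: "v = vec n (\<lambda>i. v $ i)" using v(1) by auto
    have "(\<Sum>j<n. if E i j then v $ i - v $ j else 0) = l * v $ i" if "i < n" for i
      using laplacian_matrix_mult_vec[of i n E "\<lambda>i. v $ i"] that E_irrefl v by (simp flip: vec)
    moreover have "\<exists>i<n. v $ i \<noteq> 0" using v(1,2) by (auto simp: vec_eq_iff)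
    ultimately show ?R by blast
  next
    assume ?R
    then obtain d where d: "\<exists>i<n. d i \<noteq> 0"
      "\<And>i. i < n \<Longrightarrow> (\<Sum>j<n. if E i j then d i - d j else 0) = l * d i" by blast
    have "?L *\<^sub>v vec n d = l \<cdot>\<^sub>v vec n d"
    proof (rule eq_vecI)
      fix i assume "i < dim_vec (l \<cdot>\<^sub>v vec n d)"
      then show "(?L *\<^sub>v vec n d) $ i = (l \<cdot>\<^sub>v vec n d) $ i"
        using d(2) E_irrefl by (simp add: laplacian_matrix_mult_vec)
    qed (simp add: dim)
    moreover have "vec n d \<noteq> 0\<^sub>v n" using d(1) by (auto simp: vec_eq_iff)
    ultimately show "eigenvalue ?L l"
      unfolding eigenvalue_def eigenvector_def dim(1) by (intro exI[of _ "vec n d"]) auto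
  }
qed

text \<open>The maximum \<open>l\<close> of the Rayleigh quotient is an eigenvalue, and every
  eigenvalue is the Rayleigh quotient of its eigenvector, hence at most \<open>l\<close>.\<close>

lemma max_laplacian_eigenvalue_rayleigh:
  assumes "0 < n"
  shows "dirichlet_form n E d \<le> max_laplacian_eigenvalue n E * (\<Sum>i<n. (d i)\<^sup>2)"
    and "\<exists>v. (\<Sum>i<n. (v i)\<^sup>2) = 1 \<and> dirichlet_form n E v = max_laplacian_eigenvalue n E"
proof -
  define L where "L = degree_matrix n E - adjacency_matrix n E"
  define A where "A = (\<lambda>i j. (if i = j then real (card {j. j < n \<and> E i j}) else 0)
    - (if E i j then 1 else 0))"
  have A: "(\<Sum>j<n. A i j * d j) = (\<Sum>j<n. if E i j then d i - d j else 0)" if "i < n" for i d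
  proof -
    have "(\<Sum>j<n. A i j * d j) = (L *\<^sub>v vec n d) $ i"
      using that
      by (auto simp: L_def A_def degree_matrix_def adjacency_matrix_def mat_diag_def
        mult_mat_vec_def scalar_prod_def atLeast0LessThan intro!: sum.cong)
    then show ?thesis using that E_irrefl by (simp add: L_def laplacian_matrix_mult_vec)
  qed
  have q: "(\<Sum>i<n. \<Sum>j<n. A i j * d i * d j) = dirichlet_form n E d" for d
  proof -
    have "(\<Sum>i<n. \<Sum>j<n. A i j * d i * d j) = (\<Sum>i<n. d i * (\<Sum>j<n. A i j * d j))"
      by (simp add: sum_distrib_left algebra_simps)
    then show ?thesis by (simp add: dirichlet_form_eq_inner A)
  qed
  have "A i j = A j i" for i j using E_sym by (auto simp: A_def)
  then obtain v l where v: "(\<Sum>i<n. (v i)\<^sup>2) = 1"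
    and le: "\<And>d. dirichlet_form n E d \<le> l * (\<Sum>i<n. (d i)\<^sup>2)"
    and A_eig: "\<And>i. i < n \<Longrightarrow> (\<Sum>j<n. A i j * v j) = l * v i"
    using symmetric_form_maximizer[of n A, OF _ \<open>0 < n\<close>] unfolding q by blast
  have eig: "(\<Sum>j<n. if E i j then v i - v j else 0) = l * v i" if "i < n" for i
    using A[OF that, of v] A_eig[OF that] by simp
  have form: "dirichlet_form n E d = a * (\<Sum>i<n. (d i)\<^sup>2)"
    if eig: "\<And>i. i < n \<Longrightarrow> (\<Sum>j<n. if E i j then d i - d j else 0) = a * d i" for d a
  proof -
    have "dirichlet_form n E d = (\<Sum>i<n. d i * (a * d i))"
      unfolding dirichlet_form_eq_inner by (rule sum.cong) (simp_all add: eig)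
    then show ?thesis by (simp add: sum_distrib_left power2_eq_square mult.left_commute)
  qed
  have "L \<in> carrier_mat n n"
    unfolding L_def by (rule minus_carrier_mat) (simp add: adjacency_matrix_def)
  then have "finite (spectrum L)" by (rule card_finite_spectrum(1))
  moreover have "\<exists>i<n. v i \<noteq> 0"
  proof (rule ccontr)
    assume "\<not> (\<exists>i<n. v i \<noteq> 0)"
    then have "(\<Sum>i<n. (v i)\<^sup>2) = 0" by (intro sum.neutral) auto
    then show False using v by simp
  qed
  then have "l \<in> spectrum L"
    unfolding spectrum_def L_def mem_Collect_eq eigenvalue_laplacian_matrix_iff
    using eig by blast
  moreover have "a \<le> l" if "a \<in> spectrum L" for a
  proof -
    obtain d where d: "\<exists>i<n. d i \<noteq> 0"
      "\<And>i. i < n \<Longrightarrow> (\<Sum>j<n. if E i j then d i - d j else 0) = a * d i"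
      using \<open>a \<in> spectrum L\<close>
      unfolding spectrum_def L_def mem_Collect_eq eigenvalue_laplacian_matrix_iff by blast
    have "(\<Sum>i<n. (d i)\<^sup>2) > 0" using d(1) by (auto intro: sum_pos2)
    moreover have "a * (\<Sum>i<n. (d i)\<^sup>2) \<le> l * (\<Sum>i<n. (d i)\<^sup>2)"
      using form[OF d(2)] le[of d] by simp
    ultimately show ?thesis by simp
  qed
  ultimately have l: "max_laplacian_eigenvalue n E = l"
    unfolding max_laplacian_eigenvalue_def L_def[symmetric] by (intro Max_eqI) auto
  show "dirichlet_form n E d \<le> max_laplacian_eigenvalue n E * (\<Sum>i<n. (d i)\<^sup>2)"
    using le l by simp
  show "\<exists>v. (\<Sum>i<n. (v i)\<^sup>2) = 1 \<and> dirichlet_form n E v = max_laplacian_eigenvalue n E"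
    using v form[OF eig] l by auto
qed

end

section \<open>Splitting off the mean, and comparison with the complete graph\<close>

lemma dirichlet_form_shift: "dirichlet_form n E (\<lambda>i. d i - c) = dirichlet_form n E d"
  by (simp add: dirichlet_form_def cong: if_cong)

text \<open>Pythagoras for the constant vector with entries \<open>c\<close>, the mean, and the
  orthogonal remainder.\<close>

lemma sum_squares_shift:
  fixes d :: "nat \<Rightarrow> real"
  assumes "0 < n"
  defines "c \<equiv> (\<Sum>i<n. d i) / n"
  shows "(\<Sum>i<n. (d i)\<^sup>2) = (\<Sum>i<n. (d i - c)\<^sup>2) + (\<Sum>i<n. d i)\<^sup>2 / n"
proof -
  have "(\<Sum>i<n. (d i - c)\<^sup>2) = (\<Sum>i<n. (d i)\<^sup>2) - 2 * c * (\<Sum>i<n. d i) + n * c\<^sup>2"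
    by (simp add: power2_diff sum.distrib sum_subtractf sum_distrib_left algebra_simps)
  then show ?thesis using assms by (simp add: field_simps power2_eq_square)
qed

text \<open>Adding edges can only increase the form, and for the complete graph it is
  \<open>n\<close> times the square norm minus the square of the sum.\<close>

lemma dirichlet_form_le:
  "dirichlet_form n E d \<le> n * (\<Sum>i<n. (d i)\<^sup>2)"
proof -
  have "dirichlet_form n E d \<le> (\<Sum>i<n. \<Sum>j<n. (d i - d j)\<^sup>2 / 2)"
    unfolding dirichlet_form_def by (intro sum_mono) auto
  also have "\<dots> = (\<Sum>i<n. \<Sum>j<n. (d i)\<^sup>2 / 2 + (d j)\<^sup>2 / 2 - d i * d j)"
    by (intro sum.cong) (auto simp: power2_eq_square field_simps)
  also have "\<dots> = n * (\<Sum>i<n. (d i)\<^sup>2) - (\<Sum>i<n. d i)\<^sup>2"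
    by (simp add: sum.distrib sum_subtractf power2_eq_square sum_product
      flip: sum_divide_distrib sum_distrib_left)
  also have "\<dots> \<le> n * (\<Sum>i<n. (d i)\<^sup>2)" by simp
  finally show ?thesis .
qed


section \<open>The geometric representation of a Coxeter group\<close>

text \<open>The Gram matrix of the simple roots; -1 is the limit of \<open>- cos (pi / n)\<close>
  for growing \<open>n\<close>.\<close>

definition coxeter_coeff :: "(nat \<Rightarrow> nat \<Rightarrow> enat) \<Rightarrow> nat \<Rightarrow> nat \<Rightarrow> real" where
  "coxeter_coeff m i j = (case m i j of enat n \<Rightarrow> - cos (pi / n) | \<infinity> \<Rightarrow> - 1)"

text \<open>Vectors are written in the basis of simple roots; this pairs \<open>v\<close> with the
  \<open>i\<close>-th one, so that \<open>reflection\<close> changes the \<open>i\<close>-th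
  coordinate only.\<close>

definition coxeter_form :: "nat \<Rightarrow> (nat \<Rightarrow> nat \<Rightarrow> enat) \<Rightarrow> (nat \<Rightarrow> real) \<Rightarrow> nat \<Rightarrow> real" where
  "coxeter_form k m v i = (\<Sum>l<k. v l * coxeter_coeff m l i)"

definition reflection :: "nat \<Rightarrow> (nat \<Rightarrow> nat \<Rightarrow> enat) \<Rightarrow> nat \<Rightarrow> (nat \<Rightarrow> real) \<Rightarrow> nat \<Rightarrow> real" where
  "reflection k m i v = v(i := v i - 2 * coxeter_form k m v i)"

text \<open>The exponent sign of a letter is dropped because each generator acts by an
  involution.\<close>

definition word_action :: "nat \<Rightarrow> (nat \<Rightarrow> nat \<Rightarrow> enat) \<Rightarrow> nat group_word \<Rightarrow> (nat \<Rightarrow> real) \<Rightarrow> nat \<Rightarrow> real" where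
  "word_action k m w = foldr (\<lambda>(i, b). reflection k m i) w"

section \<open>The action of words respects the Coxeter relations\<close>

context
  fixes k :: nat and m :: "nat \<Rightarrow> nat \<Rightarrow> enat"
  assumes cox: "coxeter_matrix k m"
begin

lemma coxeter_coeff_diag: "i < k \<Longrightarrow> coxeter_coeff m i i = 1"
  using cox by (simp add: coxeter_matrix_def coxeter_coeff_def one_enat_def)

lemma coxeter_coeff_sym: "i < k \<Longrightarrow> j < k \<Longrightarrow> coxeter_coeff m i j = coxeter_coeff m j i"
  using cox by (simp add: coxeter_matrix_def coxeter_coeff_def)

text \<open>For \<open>n\<close> at least 3 the angle \<open>pi / n\<close> is acute. The strict
  sign later tells apart the two products of a non-commuting pair.\<close>

lemma coxeter_coeff_neg:
  assumes "3 \<le> m i j"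
  shows "coxeter_coeff m i j < 0"
proof (cases "m i j")
  case (enat n)
  then have "3 \<le> n" using assms by (simp add: numeral_eq_enat)
  then have "pi / n < pi / 2" by (intro divide_strict_left_mono) auto
  moreover have "0 < pi / n" using \<open>3 \<le> n\<close> by simp
  ultimately have "0 < cos (pi / n)" by (intro cos_gt_zero) auto
  then show ?thesis by (simp add: coxeter_coeff_def enat)
qed (simp add: coxeter_coeff_def)

lemma coxeter_form_upd:
  "i < k \<Longrightarrow> coxeter_form k m (v(i := v i + a)) j = coxeter_form k m v j + a * coxeter_coeff m i j"
proof -
  assume i: "i < k"
  have "coxeter_form k m (v(i := v i + a)) j
      = (\<Sum>l<k. v l * coxeter_coeff m l j + (if l = i then a * coxeter_coeff m l j else 0))"
    unfolding coxeter_form_def by (intro sum.cong) (auto simp: algebra_simps)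
  also have "\<dots> = coxeter_form k m v j + a * coxeter_coeff m i j"
    using i by (simp add: sum.distrib coxeter_form_def)
  finally show ?thesis .
qed

lemma reflection_involution:
  assumes "i < k"
  shows "reflection k m i (reflection k m i v) = v"
  using coxeter_form_upd[OF assms, of v "- 2 * coxeter_form k m v i" i]
  by (simp add: reflection_def coxeter_coeff_diag assms)

text \<open>With \<open>c = cos (pi / n)\<close>, alternating the two reflections on \<open>w + a e\<^sub>i + b e\<^sub>j\<close>, where \<open>w\<close>
  is orthogonal to \<open>e\<^sub>i\<close> and \<open>e\<^sub>j\<close>, shifts the coefficient pair along a solution of
  \<open>u (t + 1) = 2 c u t - u (t - 1)\<close>, which has period \<open>2 n\<close>.\<close>

lemma reflection_power:
  assumes ij: "i < k" "j < k" and n: "m i j = enat n"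
  shows "((reflection k m i \<circ> reflection k m j) ^^ n) v = v"
proof (cases "i = j")
  case True
  then have "n = 1" using cox ij n by (simp add: coxeter_matrix_def one_enat_def)
  then show ?thesis using True ij by (simp add: reflection_involution)
next
  case False
  have "2 \<le> n" using cox ij n False by (force simp: coxeter_matrix_def numeral_eq_enat)
  define \<theta> where "\<theta> = pi / n"
  define c where "c = cos \<theta>"
  have \<theta>: "0 < \<theta>" "\<theta> < pi" using \<open>2 \<le> n\<close> by (auto simp: \<theta>_def field_simps)
  then have sin: "sin \<theta> > 0" by (rule sin_gt_zero)
  have cosB: "coxeter_coeff m i j = - c" "coxeter_coeff m j i = - c"
    using coxeter_coeff_sym[OF ij] n by (auto simp: coxeter_coeff_def c_def \<theta>_def)
  \<comment> \<open>The Gram determinant of the two simple roots: the form is nondegenerate on their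
    plane, so \<open>v\<close> has a projection onto it.\<close>
  have det: "1 - c\<^sup>2 > 0"
    using sin by (simp add: c_def flip: sin_squared_eq)
  define p q where "p = coxeter_form k m v i" and "q = coxeter_form k m v j"
  \<comment> \<open>The plane coordinates of that projection, by solving the two equations in
    \<open>ab\<close>.\<close>
  define a b where "a = (p + c * q) / (1 - c\<^sup>2)" and "b = (q + c * p) / (1 - c\<^sup>2)"
  have ab: "a - c * b = p" "b - c * a = q"
  proof -
    have "a - c * b = p * (1 - c\<^sup>2) / (1 - c\<^sup>2)" "b - c * a = q * (1 - c\<^sup>2) / (1 - c\<^sup>2)"
      unfolding a_def b_def times_divide_eq_right diff_divide_distrib[symmetric]
      by (simp_all add: algebra_simps power2_eq_square)
    then show "a - c * b = p" "b - c * a = q" using det by simp_all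
  qed
  \<comment> \<open>Keeps the component of \<open>v\<close> orthogonal to the plane and replaces the
    plane coordinates by \<open>A\<close> and \<open>B\<close>.\<close>
  define w where "w = (\<lambda>A B. v(i := v i - a + A, j := v j - b + B))"
  have w_form: "coxeter_form k m (w A B) i = A - c * B" "coxeter_form k m (w A B) j = B - c * A"
    for A B
  proof -
    define u where "u = v(i := v i + (A - a))"
    have "w A B = u(j := u j + (B - b))" using False by (auto simp: w_def u_def)
    then have "coxeter_form k m (w A B) l
        = coxeter_form k m v l + (A - a) * coxeter_coeff m i l + (B - b) * coxeter_coeff m j l" for l
      by (simp only: coxeter_form_upd[OF ij(2)] u_def coxeter_form_upd[OF ij(1)])
    from this[of i] this[of j]
    have "coxeter_form k m (w A B) i = p + (A - a) * 1 + (B - b) * (- c)"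
      "coxeter_form k m (w A B) j = q + (A - a) * (- c) + (B - b) * 1"
      by (simp_all only: coxeter_coeff_diag cosB ij flip: p_def q_def)
    then show "coxeter_form k m (w A B) i = A - c * B" "coxeter_form k m (w A B) j = B - c * A"
      unfolding ab[symmetric] by (simp_all add: algebra_simps)
  qed
  have refl: "reflection k m i (w A B) = w (2 * c * B - A) B"
    "reflection k m j (w A B) = w A (2 * c * A - B)" for A B
    using False by (auto simp: reflection_def w_form) (auto simp: w_def fun_eq_iff)
  \<comment> \<open>Chosen so that \<open>u (- 1) = b\<close>, while \<open>u 0 = a\<close> holds
    for any \<open>\<beta>\<close>.\<close>
  define \<beta> where "\<beta> = (a * c - b) / sin \<theta>"
  define u where "u = (\<lambda>t. a * cos (t * \<theta>) + \<beta> * sin (t * \<theta>))"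
  have rec: "u (t + 1) = 2 * c * u t - u (t - 1)" for t
    by (simp add: u_def c_def left_diff_distrib distrib_right cos_add sin_add cos_diff sin_diff
      algebra_simps)
  have step: "((reflection k m i \<circ> reflection k m j) ^^ t) (w (u 0) (u (- 1)))
      = w (u (2 * real t)) (u (2 * real t - 1))" for t :: nat
  proof (induction t)
    case (Suc t)
    have "((reflection k m i \<circ> reflection k m j) ^^ Suc t) (w (u 0) (u (- 1)))
        = w (2 * c * (2 * c * u (2 * real t) - u (2 * real t - 1)) - u (2 * real t))
          (2 * c * u (2 * real t) - u (2 * real t - 1))"
      by (simp add: Suc.IH refl)
    moreover have "2 * c * u (2 * real t) - u (2 * real t - 1) = u (2 * real (Suc t) - 1)"
      using rec[of "2 * real t"] by (simp add: algebra_simps)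
    moreover have "2 * c * u (2 * real (Suc t) - 1) - u (2 * real t) = u (2 * real (Suc t))"
      using rec[of "2 * real (Suc t) - 1"] by (simp add: algebra_simps)
    ultimately show ?case by metis
  qed simp
  have "u 0 = a" "u (- 1) = b" using sin by (auto simp: u_def c_def \<beta>_def)
  moreover have "2 * real n * \<theta> = 2 * pi" using \<open>2 \<le> n\<close> by (simp add: \<theta>_def)
  then have "cos (2 * real n * \<theta>) = 1" "sin (2 * real n * \<theta>) = 0"
    by (simp_all only: cos_two_pi sin_two_pi)
  then have "u (2 * real n) = a" "u (2 * real n - 1) = b"
    using sin
    by (simp_all add: u_def c_def \<beta>_def left_diff_distrib cos_diff sin_diff diff_divide_distrib)
  moreover have "w a b = v" by (simp add: w_def)
  ultimately show ?thesis using step[of n] by simp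
qed

lemma word_action_append: "word_action k m (u @ v) = word_action k m u \<circ> word_action k m v"
  by (simp add: word_action_def fun_eq_iff)

lemma word_action_relator:
  assumes "r \<in> coxeter_relators k m"
  shows "word_action k m r = id"
proof -
  obtain i j n where r: "r = concat (replicate n [(i, True), (j, True)])"
    and ij: "i < k" "j < k" and n: "m i j = enat n"
    using assms unfolding coxeter_relators_def by blast
  have "word_action k m (concat (replicate t [(i, True), (j, True)]))
      = (reflection k m i \<circ> reflection k m j) ^^ t" for t
    by (induction t) (auto simp: word_action_def)
  then show ?thesis using reflection_power[OF ij n] by (auto simp: r)
qed

text \<open>Cancelling pairs and relators act as the identity, so the action descends to the
  presented group.\<close>

lemma word_action_cong:
  assumes "presented_eq {..<k} (coxeter_relators k m) u v"
  shows "word_action k m u = word_action k m v"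
  using assms
proof (induction rule: presented_eq.induct)
  case (cancel u v i b)
  then have "word_action k m [(i, b), (i, \<not> b)] = id"
    by (auto simp: word_action_def reflection_involution)
  then show ?case by (simp only: word_action_append id_comp)
next
  case (relator u v r)
  then show ?case by (simp only: word_action_append word_action_relator id_comp)
qed auto

end

section \<open>Coincidences among products of at most two generators\<close>

locale coxeter =
  fixes W :: "('a, 'b) monoid_scheme" (structure)
    and k :: nat and s :: "nat \<Rightarrow> 'a" and m :: "nat \<Rightarrow> nat \<Rightarrow> enat"
  assumes coxeter: "coxeter_group W k s m"
begin

lemma matrix: "coxeter_matrix k m" and inj: "inj_on s {..<k}"
  and presentation: "has_presentation W s {..<k} (coxeter_relators k m)"
  using coxeter by (auto simp: coxeter_group_def)

sublocale group W
  using presentation by (simp add: has_presentation_def)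

lemma gen_closed [simp]: "i < k \<Longrightarrow> s i \<in> carrier W"
  using presentation by (auto simp: has_presentation_def)

lemma relator_value:
  assumes "r \<in> coxeter_relators k m"
  shows "word_value W s r = \<one>"
proof -
  have r: "r \<in> lists ({..<k} \<times> UNIV)" using assms presentation by (auto simp: has_presentation_def)
  have "presented_eq {..<k} (coxeter_relators k m) r []"
    using presented_eq.relator[of "[]" _ "[]" r] assms by simp
  then have "word_value W s r = word_value W s []"
    using presentation r by (auto simp: has_presentation_def)
  then show ?thesis by (simp add: word_value_def)
qed

lemma gen_square:
  assumes "i < k"
  shows "s i \<otimes> s i = \<one>"
proof -
  have "[(i, True), (i, True)] \<in> coxeter_relators k m"
    unfolding coxeter_relators_def mem_Collect_eq
    using assms matrix by (intro exI[of _ i] exI[of _ 1]) (auto simp: coxeter_matrix_def one_enat_def)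
  from relator_value[OF this] show ?thesis using assms by (simp add: word_value_def)
qed

lemma inv_gen: "i < k \<Longrightarrow> inv (s i) = s i"
  by (simp add: gen_square inv_equality)

text \<open>Without a diagram edge \<open>m i j\<close> is 2, so the product of the two generators
  is its own inverse, which is the reversed product.\<close>

lemma gen_commute:
  assumes "i < k" "j < k" "i \<noteq> j" "\<not> coxeter_diagram k m i j"
  shows "s i \<otimes> s j = s j \<otimes> s i"
proof -
  have "m i j = enat 2"
  proof (cases "m i j")
    case (enat n)
    have "2 \<le> m i j" using matrix assms(1-3) by (simp add: coxeter_matrix_def)
    moreover have "\<not> 3 \<le> m i j" using assms by (simp add: coxeter_diagram_def)
    ultimately have "n = 2" by (simp add: enat numeral_eq_enat)
    then show ?thesis using enat by simp
  qed (use assms in \<open>simp add: coxeter_diagram_def\<close>)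
  then have "[(i, True), (j, True), (i, True), (j, True)] \<in> coxeter_relators k m"
    unfolding coxeter_relators_def mem_Collect_eq
    using assms by (intro exI[of _ i] exI[of _ j] exI[of _ 2]) (auto simp: numeral_2_eq_2)
  from relator_value[OF this] have "(s i \<otimes> s j) \<otimes> (s i \<otimes> s j) = \<one>"
    using assms by (simp add: word_value_def m_assoc)
  then have "s i \<otimes> s j = inv (s i \<otimes> s j)"
    using assms by (metis gen_closed inv_equality m_closed)
  also have "\<dots> = s j \<otimes> s i"
    using assms by (simp add: inv_mult_group inv_gen)
  finally show ?thesis .
qed

text \<open>The device for telling group elements apart: a vector on which two words act differently
  separates their values.\<close>

lemma word_action_eq:
  assumes "foldr (\<otimes>) (map s is) \<one> = foldr (\<otimes>) (map s js) \<one>"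
    and "set is \<subseteq> {..<k}" "set js \<subseteq> {..<k}"
  shows "foldr (reflection k m) is v = foldr (reflection k m) js v"
proof -
  define w :: "nat list \<Rightarrow> nat group_word" where "w = map (\<lambda>i. (i, True))"
  have lists: "w is \<in> lists ({..<k} \<times> UNIV)" "w js \<in> lists ({..<k} \<times> UNIV)"
    using assms(2,3) by (auto simp: w_def)
  have val: "word_value W s (w l) = foldr (\<otimes>) (map s l) \<one>" for l
    by (induction l) (auto simp: w_def word_value_def)
  have act: "word_action k m (w l) v = foldr (reflection k m) l v" for l v
    by (induction l) (auto simp: w_def word_action_def)
  have "presented_eq {..<k} (coxeter_relators k m) (w is) (w js)"
    using presentation lists assms(1) unfolding has_presentation_def val[symmetric] by blast
  from word_action_cong[OF matrix this] show ?thesis by (metis act)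
qed

definition root :: "nat \<Rightarrow> nat \<Rightarrow> real" where
  "root i = (\<lambda>l. if l = i then 1 else 0)"

lemma coxeter_form_root: "i < k \<Longrightarrow> coxeter_form k m (root i) j = coxeter_coeff m i j"
  by (simp add: coxeter_form_def root_def if_distrib[of "\<lambda>x. x * _"] cong: if_cong)

lemma reflection_root: "i < k \<Longrightarrow> reflection k m i (root i) = (\<lambda>l. - root i l)"
  using matrix
  by (simp add: reflection_def coxeter_form_root coxeter_coeff_diag) (simp add: root_def fun_eq_iff)

lemma gen_neq_one:
  assumes "i < k"
  shows "s i \<noteq> \<one>"
proof
  assume "s i = \<one>"
  then have "foldr (reflection k m) [i] (root i) = foldr (reflection k m) [] (root i)"
    using assms by (intro word_action_eq) auto
  then have "reflection k m i (root i) i = root i i" by simp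
  then show False using assms by (simp add: reflection_root) (simp add: root_def)
qed

lemma gen_mult_neq_one:
  assumes "i < k" "j < k" "i \<noteq> j"
  shows "s i \<otimes> s j \<noteq> \<one>"
proof
  assume "s i \<otimes> s j = \<one>"
  then have "s i \<otimes> s j = s i \<otimes> s i" using gen_square assms by simp
  then have "s i = s j" using assms by simp
  then show False using inj assms by (auto dest: inj_onD)
qed

text \<open>The inner reflection negates the root, and the outer one then alters only coordinate
  \<open>i\<close>.\<close>

lemma reflection_reflection_root:
  assumes "i < k" "j < k" "i \<noteq> j"
  shows "reflection k m i (reflection k m j (root j)) j = - 1"
    and "reflection k m i (reflection k m j (root j)) i = 2 * coxeter_coeff m i j"
proof -
  have "coxeter_form k m (\<lambda>l. - root j l) i = - coxeter_coeff m j i"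
    using coxeter_form_root[OF assms(2), of i] by (simp add: coxeter_form_def sum_negf)
  then show "reflection k m i (reflection k m j (root j)) j = - 1"
    "reflection k m i (reflection k m j (root j)) i = 2 * coxeter_coeff m i j"
    unfolding reflection_root[OF assms(2)] using assms coxeter_coeff_sym[OF matrix assms(1,2)]
    by (simp_all add: reflection_def root_def)
qed

text \<open>The product makes the \<open>j\<close>-th coordinate of \<open>root j\<close> equal to
  -1. A single reflection can do so only if \<open>l = j\<close>, and then \<open>s i\<close> would
  be trivial.\<close>

lemma gen_mult_neq_gen:
  assumes "i < k" "j < k" "l < k" "i \<noteq> j"
  shows "s i \<otimes> s j \<noteq> s l"
proof
  assume eq: "s i \<otimes> s j = s l"
  then have "foldr (reflection k m) [i, j] (root j) = foldr (reflection k m) [l] (root j)"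
    using assms by (intro word_action_eq) auto
  then have "reflection k m i (reflection k m j (root j)) = reflection k m l (root j)"
    by simp
  then have "reflection k m l (root j) j = - 1"
    using reflection_reflection_root(1)[OF assms(1,2,4)] by simp
  then have "l = j" by (auto simp: reflection_def root_def split: if_splits)
  then have "s i = \<one>" using eq assms by simp
  then show False using gen_neq_one assms by simp
qed

text \<open>If neither \<open>i'\<close> nor \<open>j'\<close> is \<open>j\<close>, the right-hand
  product leaves the \<open>j\<close>-th coordinate of \<open>root j\<close> at 1, whereas the
  left-hand one turns it into -1.\<close>

lemma gen_mult_eq_second:
  assumes "i < k" "j < k" "i' < k" "j' < k" "i \<noteq> j" "s i \<otimes> s j = s i' \<otimes> s j'"
  shows "j \<in> {i', j'}"
proof (rule ccontr)
  assume "j \<notin> {i', j'}"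
  then have "reflection k m i' (reflection k m j' (root j)) j = root j j"
    by (simp add: reflection_def)
  moreover have "foldr (reflection k m) [i, j] (root j) = foldr (reflection k m) [i', j'] (root j)"
    using assms by (intro word_action_eq) auto
  ultimately show False
    using reflection_reflection_root(1)[OF assms(1,2,5)] by (simp add: root_def)
qed

text \<open>Applying \<open>gen_mult_eq_second\<close> to the equation and to its inverse puts both
  \<open>j\<close> and \<open>i\<close> among \<open>i'\<close> and \<open>j'\<close>; a diagram
  edge excludes the swap.\<close>

lemma gen_mult_inj:
  assumes "i < k" "j < k" "i' < k" "j' < k" "i \<noteq> j"
    and eq: "s i \<otimes> s j = s i' \<otimes> s j'"
  shows "i' = i \<and> j' = j \<or> i' = j \<and> j' = i \<and> \<not> coxeter_diagram k m i j"
proof -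
  have "inv (s a \<otimes> s b) = s b \<otimes> s a" if "a < k" "b < k" for a b
    using that by (simp add: inv_mult_group inv_gen)
  then have "s j \<otimes> s i = s j' \<otimes> s i'" using assms by metis
  then have "i \<in> {i', j'}" "j \<in> {i', j'}"
    using gen_mult_eq_second[of j i j' i'] gen_mult_eq_second[of i j i' j'] assms by auto
  moreover have "\<not> coxeter_diagram k m i j" if "i' = j" "j' = i"
  proof
    assume "coxeter_diagram k m i j"
    then have neg: "coxeter_coeff m i j < 0"
      using coxeter_coeff_neg matrix by (auto simp: coxeter_diagram_def)
    \<comment> \<open>The \<open>j\<close>-th coordinates of the two images of \<open>root i\<close>
      are opposite, and nonzero along an edge.\<close>
    have "foldr (reflection k m) [i, j] (root i) = foldr (reflection k m) [j, i] (root i)"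
      using eq that assms by (intro word_action_eq) auto
    then have "reflection k m i (reflection k m j (root i)) j = 2 * coxeter_coeff m j i"
      using reflection_reflection_root(2)[of j i] assms by simp
    moreover have "reflection k m i (reflection k m j (root i)) j = - 2 * coxeter_coeff m i j"
      using assms by (simp add: reflection_def coxeter_form_root) (simp add: root_def)
    ultimately show False using neg coxeter_coeff_sym[OF matrix assms(1,2)] by simp
  qed
  ultimately show ?thesis using assms by auto
qed

end


section \<open>Curvature of the Cayley graph\<close>

lemma Gamma_commute: "Gamma E f g = Gamma E g f"
  by (simp add: Gamma_def mult.commute algebra_simps)

context coxeter
begin

section \<open>The operators in terms of increments along generators\<close>

abbreviation cay :: "'a \<Rightarrow> 'a \<Rightarrow> bool" where
  "cay \<equiv> cayley_graph W (s ` {..<k})"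

lemma gen_cancel: "i < k \<Longrightarrow> x \<in> carrier W \<Longrightarrow> x \<otimes> s i \<otimes> s i = x"
  by (simp add: m_assoc gen_square)

lemma laplacian_cayley:
  assumes "x \<in> carrier W"
  shows "laplacian cay f x = (\<Sum>i<k. f (x \<otimes> s i) - f x)"
proof -
  have "{y. cay x y} = (\<lambda>i. x \<otimes> s i) ` {..<k}"
    using assms by (auto simp: cayley_graph_def)
  moreover have "inj_on (\<lambda>i. x \<otimes> s i) {..<k}"
    using assms inj by (auto simp: inj_on_def)
  ultimately show ?thesis by (simp add: laplacian_def sum.reindex)
qed

lemma Gamma_cayley:
  assumes "x \<in> carrier W"
  shows "Gamma cay f g x = (\<Sum>i<k. (f (x \<otimes> s i) - f x) * (g (x \<otimes> s i) - g x)) / 2"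
  unfolding Gamma_def laplacian_cayley[OF assms] sum_distrib_left sum_subtractf[symmetric]
  by (intro arg_cong[of _ _ "\<lambda>t. t / 2"] sum.cong) (auto simp: algebra_simps)

text \<open>Each two-step increment \<open>a i j\<close> enters quadratically; completing the square
  centres it at \<open>2 * d i\<close>.\<close>

lemma Gamma2_cayley:
  fixes f :: "'a \<Rightarrow> real"
  assumes x: "x \<in> carrier W"
  defines "d \<equiv> \<lambda>i. f (x \<otimes> s i) - f x"
    and "a \<equiv> \<lambda>i j. f (x \<otimes> s i \<otimes> s j) - f x"
  shows "2 * Gamma2 cay f f x = (\<Sum>i<k. \<Sum>j<k. (a i j - 2 * d i)\<^sup>2 / 2 - (d i)\<^sup>2 + d i * d j)"
proof -
  have d: "f (x \<otimes> s i) = d i + f x" and a: "f (x \<otimes> s i \<otimes> s j) = a i j + f x" for i j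
    by (auto simp: d_def a_def)
  have "laplacian cay (Gamma cay f f) x
      = (\<Sum>i<k. (\<Sum>j<k. (a i j - d i)\<^sup>2) / 2 - (\<Sum>j<k. (d j)\<^sup>2) / 2)"
    unfolding laplacian_cayley[OF x]
    by (intro sum.cong) (auto simp: Gamma_cayley x d a power2_eq_square)
  also have "\<dots> = (\<Sum>i<k. \<Sum>j<k. (a i j - d i)\<^sup>2 / 2 - (d j)\<^sup>2 / 2)"
    by (simp add: sum_subtractf sum_divide_distrib)
  \<comment> \<open>The second term depends on one index only, and both indices have the same range,
    so \<open>d j\<close> may become \<open>d i\<close>.\<close>
  also have "\<dots> = (\<Sum>i<k. \<Sum>j<k. (a i j - d i)\<^sup>2 / 2 - (d i)\<^sup>2 / 2)"
    by (simp add: sum_subtractf flip: sum_divide_distrib sum_distrib_left)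
  finally have 1: "laplacian cay (Gamma cay f f) x = \<dots>" .
  have 2: "2 * Gamma cay f (laplacian cay f) x = (\<Sum>i<k. \<Sum>j<k. d i * (a i j - d i - d j))"
  proof -
    have "laplacian cay f (x \<otimes> s i) - laplacian cay f x = (\<Sum>j<k. a i j - d i - d j)"
      if "i < k" for i
      using that by (simp add: laplacian_cayley x d a sum_subtractf)
    then show ?thesis by (simp add: Gamma_cayley x d flip: sum_distrib_left)
  qed
  have "2 * Gamma2 cay f f x = laplacian cay (Gamma cay f f) x - 2 * Gamma cay f (laplacian cay f) x"
    using Gamma_commute[of cay f "laplacian cay f"] by (simp add: Gamma2_def)
  also have "\<dots> = (\<Sum>i<k. \<Sum>j<k. (a i j - 2 * d i)\<^sup>2 / 2 - (d i)\<^sup>2 + d i * d j)"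
    unfolding 1 2 sum_subtractf[symmetric]
    by (intro sum.cong) (auto simp: power2_eq_square field_simps)
  finally show ?thesis .
qed

lemma diagram_sym: "coxeter_diagram k m i j \<longleftrightarrow> coxeter_diagram k m j i"
  using matrix by (auto simp: coxeter_diagram_def coxeter_matrix_def)

lemma diagram_rayleigh:
  assumes "0 < k"
  shows "dirichlet_form k (coxeter_diagram k m) d
      \<le> max_laplacian_eigenvalue k (coxeter_diagram k m) * (\<Sum>i<k. (d i)\<^sup>2)"
    and "\<exists>v. (\<Sum>i<k. (v i)\<^sup>2) = 1
      \<and> dirichlet_form k (coxeter_diagram k m) v = max_laplacian_eigenvalue k (coxeter_diagram k m)"
proof -
  have "\<not> coxeter_diagram k m i i" for i by (simp add: coxeter_diagram_def)
  note max_laplacian_eigenvalue_rayleigh[where E = "coxeter_diagram k m",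
      OF diagram_sym[THEN iffD1] this assms]
  then show "dirichlet_form k (coxeter_diagram k m) d
      \<le> max_laplacian_eigenvalue k (coxeter_diagram k m) * (\<Sum>i<k. (d i)\<^sup>2)"
    "\<exists>v. (\<Sum>i<k. (v i)\<^sup>2) = 1
      \<and> dirichlet_form k (coxeter_diagram k m) v = max_laplacian_eigenvalue k (coxeter_diagram k m)"
    by blast+
qed

text \<open>The terms for \<open>(i, j)\<close> and \<open>(j, i)\<close> are added. For a commuting
  pair both contain the same two-step value, so their squares merge into one centred at
  \<open>d i + d j\<close>, which absorbs the cross terms; the diagonal returns to
  \<open>x\<close>.\<close>

lemma Gamma2_symmetrized:
  fixes f :: "'a \<Rightarrow> real"
  assumes x: "x \<in> carrier W"
  defines "d \<equiv> \<lambda>i. f (x \<otimes> s i) - f x"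
    and "a \<equiv> \<lambda>i j. f (x \<otimes> s i \<otimes> s j) - f x"
  shows "Gamma2 cay f f x = (\<Sum>i<k. (d i)\<^sup>2) - dirichlet_form k (coxeter_diagram k m) d / 2
    + (\<Sum>i<k. \<Sum>j<k. if i = j then 0
        else if coxeter_diagram k m i j then (a i j - 2 * d i)\<^sup>2 / 4
        else (a i j - d i - d j)\<^sup>2 / 4)"
    (is "_ = _ - _ + (\<Sum>i<k. \<Sum>j<k. ?R i j)")
proof -
  define T where "T = (\<lambda>i j. (a i j - 2 * d i)\<^sup>2 / 2 - (d i)\<^sup>2 + d i * d j)"
  \<comment> \<open>The part of the symmetrized summand that is free of two-step values.\<close>
  define D where "D = (\<lambda>i j. (if i = j then 4 * (d i)\<^sup>2 else 0)
    - 2 * (if coxeter_diagram k m i j then (d i - d j)\<^sup>2 / 2 else 0))"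
  have T: "T i j + T j i = D i j + 2 * ?R i j + 2 * ?R j i" if "i < k" "j < k" for i j
  proof -
    consider "i = j" | "i \<noteq> j" "coxeter_diagram k m i j" | "i \<noteq> j" "\<not> coxeter_diagram k m i j"
      by blast
    then show ?thesis
    proof cases
      case 1
      then have "a i j = 0" using that x by (simp add: a_def gen_cancel)
      then show ?thesis using 1 by (simp add: T_def D_def coxeter_diagram_def power2_eq_square)
    next
      case 2
      then show ?thesis using diagram_sym[of i j]
        by (simp add: T_def D_def power2_eq_square field_simps)
    next
      case 3
      then have "a i j = a j i" using that x gen_commute[of i j] by (simp add: a_def m_assoc)
      then show ?thesis using 3 diagram_sym[of i j]
        by (simp add: T_def D_def power2_eq_square field_simps)
    qed
  qed
  have "4 * Gamma2 cay f f x = (\<Sum>i<k. \<Sum>j<k. T i j) + (\<Sum>i<k. \<Sum>j<k. T j i)"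
    using Gamma2_cayley[OF x, of f] sum.swap[of "\<lambda>i j. T j i"]
    unfolding T_def d_def a_def by simp
  also have "\<dots> = (\<Sum>i<k. \<Sum>j<k. D i j + 2 * ?R i j + 2 * ?R j i)"
    unfolding sum.distrib[symmetric] by (intro sum.cong) (auto simp: T simp del: if_split)
  also have "\<dots> = (\<Sum>i<k. \<Sum>j<k. D i j) + 2 * (\<Sum>i<k. \<Sum>j<k. ?R i j) + 2 * (\<Sum>i<k. \<Sum>j<k. ?R j i)"
    unfolding sum.distrib sum_distrib_left ..
  also have "(\<Sum>i<k. \<Sum>j<k. ?R j i) = (\<Sum>i<k. \<Sum>j<k. ?R i j)" by (rule sum.swap)
  also have "(\<Sum>i<k. \<Sum>j<k. D i j)
      = 4 * (\<Sum>i<k. (d i)\<^sup>2) - 2 * dirichlet_form k (coxeter_diagram k m) d"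
    unfolding D_def sum_subtractf dirichlet_form_def sum_distrib_left
    by (simp cong: if_cong)
  finally show ?thesis by linarith
qed

lemma Gamma2_lower_bound:
  assumes "x \<in> carrier W"
  shows "(\<Sum>i<k. (f (x \<otimes> s i) - f x)\<^sup>2)
      - dirichlet_form k (coxeter_diagram k m) (\<lambda>i. f (x \<otimes> s i) - f x) / 2
    \<le> Gamma2 cay f f x"
  unfolding Gamma2_symmetrized[OF assms] by (simp add: sum_nonneg)

text \<open>The spheres of radius 0, 1 and 2 are disjoint, and points at distance 2 coincide only
  through commutation, so all remainder squares can vanish at once.\<close>

lemma Gamma2_minimizer:
  assumes x: "x \<in> carrier W"
  obtains f where "\<And>i. i < k \<Longrightarrow> f (x \<otimes> s i) - f x = d i"
    and "Gamma2 cay f f x = (\<Sum>i<k. (d i)\<^sup>2) - dirichlet_form k (coxeter_diagram k m) d / 2"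
proof -
  \<comment> \<open>The zeros of the remainder squares in \<open>Gamma2_symmetrized\<close>.\<close>
  define b where "b = (\<lambda>i j. if coxeter_diagram k m i j then 2 * d i else d i + d j)"
  define P where "P = (\<lambda>y (i, j). i < k \<and> j < k \<and> i \<noteq> j \<and> y = x \<otimes> s i \<otimes> s j)"
  \<comment> \<open>Beyond distance 2 the choice is arbitrary, which is harmless since
    \<open>Gamma2\<close> at \<open>x\<close> does not see those points.\<close>
  define f where "f = (\<lambda>y. if y = x then 0
    else if \<exists>i<k. y = x \<otimes> s i then d (SOME i. i < k \<and> y = x \<otimes> s i)
    else case_prod b (SOME p. P y p))"
  have f0: "f x = 0" by (simp add: f_def)
  have f1: "f (x \<otimes> s i) = d i" if i: "i < k" for i
  proof -
    have "(SOME j. j < k \<and> x \<otimes> s i = x \<otimes> s j) = i"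
      using i x inj by (intro some_equality) (auto dest: inj_onD)
    then show ?thesis using i x gen_neq_one[OF i] by (auto simp: f_def)
  qed
  have f2: "f (x \<otimes> s i \<otimes> s j) = b i j" if ij: "i < k" "j < k" "i \<noteq> j" for i j
  proof -
    let ?y = "x \<otimes> s i \<otimes> s j"
    have "?y \<noteq> x" using gen_mult_neq_one[OF ij] ij x by (simp add: m_assoc)
    moreover have "?y \<noteq> x \<otimes> s l" if "l < k" for l
      using gen_mult_neq_gen[OF ij(1,2) that ij(3)] ij x that by (simp add: m_assoc)
    moreover have "case_prod b (SOME p. P ?y p) = b i j"
    proof -
      obtain i' j' where p: "(SOME p. P ?y p) = (i', j')" by fastforce
      have "P ?y (i, j)" using ij by (simp add: P_def)
      then have "P ?y (i', j')" using someI[of "P ?y"] by (simp flip: p)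
      then have "i' < k" "j' < k" "s i \<otimes> s j = s i' \<otimes> s j'"
        using ij x by (auto simp: P_def m_assoc)
      then have "i' = i \<and> j' = j \<or> i' = j \<and> j' = i \<and> \<not> coxeter_diagram k m i j"
        using gen_mult_inj ij by blast
      \<comment> \<open>The chosen pair may be the swapped one, but only for a commuting pair, where
        \<open>b\<close> is symmetric.\<close>
      then show ?thesis using diagram_sym[of i j] by (auto simp: p b_def)
    qed
    ultimately show ?thesis by (auto simp: f_def)
  qed
  have "Gamma2 cay f f x = (\<Sum>i<k. (d i)\<^sup>2) - dirichlet_form k (coxeter_diagram k m) d / 2
      + (\<Sum>i<k. \<Sum>j<k. if i = j then 0
          else if coxeter_diagram k m i j then (b i j - 2 * d i)\<^sup>2 / 4
          else (b i j - d i - d j)\<^sup>2 / 4)"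
    unfolding Gamma2_symmetrized[OF x] dirichlet_form_def
    by (intro arg_cong2[of _ _ _ _ "(+)"] arg_cong2[of _ _ _ _ "(-)"]
      arg_cong[of _ _ "\<lambda>t. t / 2"] sum.cong) (auto simp: f0 f1 f2)
  also have "(\<Sum>i<k. \<Sum>j<k. if i = j then 0
          else if coxeter_diagram k m i j then (b i j - 2 * d i)\<^sup>2 / 4
          else (b i j - d i - d j)\<^sup>2 / 4) = 0"
    by (intro sum.neutral ballI) (auto simp: b_def)
  finally show ?thesis using that[of f] f0 f1 by simp
qed

section \<open>From the curvature-dimension inequality to an eigenvalue\<close>

text \<open>Only \<open>Gamma2\<close> depends on the two-step values of \<open>f\<close>. Its sharp
  lower bound for given \<open>d\<close> thus replaces it, and the inequality is doubled.\<close>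

lemma curvature_dimension_cayley_iff:
  fixes N :: ereal
  assumes x: "x \<in> carrier W"
  defines "r \<equiv> real_of_ereal (1 / N)"
  shows "curvature_dimension cay x K N \<longleftrightarrow>
    (\<forall>d :: nat \<Rightarrow> real. dirichlet_form k (coxeter_diagram k m) d + 2 * r * (\<Sum>i<k. d i)\<^sup>2
      \<le> (2 - K) * (\<Sum>i<k. (d i)\<^sup>2))"
proof
  assume cd: "curvature_dimension cay x K N"
  show "\<forall>d :: nat \<Rightarrow> real. dirichlet_form k (coxeter_diagram k m) d + 2 * r * (\<Sum>i<k. d i)\<^sup>2
      \<le> (2 - K) * (\<Sum>i<k. (d i)\<^sup>2)"
  proof
    fix d :: "nat \<Rightarrow> real"
    obtain f where f: "\<And>i. i < k \<Longrightarrow> f (x \<otimes> s i) - f x = d i"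
      "Gamma2 cay f f x = (\<Sum>i<k. (d i)\<^sup>2) - dirichlet_form k (coxeter_diagram k m) d / 2"
      using Gamma2_minimizer[OF x] by blast
    have "r * (\<Sum>i<k. d i)\<^sup>2 + K * ((\<Sum>i<k. (d i)\<^sup>2) / 2) \<le> Gamma2 cay f f x"
      using cd f(1)
      by (auto simp: curvature_dimension_def r_def laplacian_cayley Gamma_cayley x power2_eq_square
        dest!: spec[of _ f])
    then show "dirichlet_form k (coxeter_diagram k m) d + 2 * r * (\<Sum>i<k. d i)\<^sup>2
      \<le> (2 - K) * (\<Sum>i<k. (d i)\<^sup>2)"
      unfolding f(2) by (simp add: algebra_simps)
  qed
next
  assume le: "\<forall>d :: nat \<Rightarrow> real. dirichlet_form k (coxeter_diagram k m) d + 2 * r * (\<Sum>i<k. d i)\<^sup>2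
      \<le> (2 - K) * (\<Sum>i<k. (d i)\<^sup>2)"
  show "curvature_dimension cay x K N"
    unfolding curvature_dimension_def r_def[symmetric]
  proof
    fix f :: "'a \<Rightarrow> real"
    define d where "d = (\<lambda>i. f (x \<otimes> s i) - f x)"
    have "r * (\<Sum>i<k. d i)\<^sup>2 + K * ((\<Sum>i<k. (d i)\<^sup>2) / 2)
        \<le> (\<Sum>i<k. (d i)\<^sup>2) - dirichlet_form k (coxeter_diagram k m) d / 2"
      using le[rule_format, of d] by (simp add: algebra_simps)
    also have "\<dots> \<le> Gamma2 cay f f x"
      using Gamma2_lower_bound[OF x, of f] by (simp add: d_def)
    finally show "r * (laplacian cay f x)\<^sup>2 + K * Gamma cay f f x \<le> Gamma2 cay f f x"
      by (simp add: laplacian_cayley Gamma_cayley x d_def power2_eq_square)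
  qed
qed

lemma curvature_function_cayley:
  assumes x: "x \<in> carrier W" and k: "0 < k" and r: "0 \<le> real_of_ereal (1 / N)"
  shows "curvature_function cay x N
    = 2 - max (max_laplacian_eigenvalue k (coxeter_diagram k m)) (2 * k * real_of_ereal (1 / N))"
proof -
  define r where "r = real_of_ereal (1 / N)"
  define \<mu> where "\<mu> = max_laplacian_eigenvalue k (coxeter_diagram k m)"
  define Q where "Q = dirichlet_form k (coxeter_diagram k m)"
  note Q_le = diagram_rayleigh(1)[OF k, folded \<mu>_def Q_def]
  obtain v where v: "(\<Sum>i<k. (v i)\<^sup>2) = 1" "Q v = \<mu>"
    using diagram_rayleigh(2)[OF k, folded \<mu>_def Q_def] by blast
  have "curvature_dimension cay x K N \<longleftrightarrow> K \<le> 2 - max \<mu> (2 * k * r)" for K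
    unfolding curvature_dimension_cayley_iff[OF x] Q_def[symmetric] r_def[symmetric]
  proof
    assume le: "\<forall>d. Q d + 2 * r * (\<Sum>i<k. d i)\<^sup>2 \<le> (2 - K) * (\<Sum>i<k. (d i)\<^sup>2)"
    have "\<mu> + 2 * r * (\<Sum>i<k. v i)\<^sup>2 \<le> 2 - K"
      using le[rule_format, of v] v by simp
    \<comment> \<open>The maximizer \<open>v\<close> is not known to be orthogonal to constants, so
      the sign of \<open>r\<close> is used to drop this term.\<close>
    moreover have "0 \<le> 2 * r * (\<Sum>i<k. v i)\<^sup>2" using r by (simp add: r_def)
    ultimately have "\<mu> \<le> 2 - K" by linarith
    \<comment> \<open>On the constant vector the Dirichlet form vanishes, leaving only the dimension
      term.\<close>
    moreover have "2 * k * r * k \<le> (2 - K) * k"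
      using le[rule_format, of "\<lambda>_. 1"]
      by (simp add: Q_def dirichlet_form_def power2_eq_square algebra_simps cong: if_cong)
    then have "2 * k * r \<le> 2 - K" using k by (simp add: mult.commute mult.left_commute)
    ultimately show "K \<le> 2 - max \<mu> (2 * k * r)" by simp
  next
    assume K: "K \<le> 2 - max \<mu> (2 * k * r)"
    show "\<forall>d. Q d + 2 * r * (\<Sum>i<k. d i)\<^sup>2 \<le> (2 - K) * (\<Sum>i<k. (d i)\<^sup>2)"
    proof
      fix d
      \<comment> \<open>The mean: \<open>A\<close> and \<open>B\<close> are the square norms of the
        mean-free and constant parts of \<open>d\<close>; the Dirichlet form sees only the first,
        the dimension term only the second.\<close>
      define c where "c = (\<Sum>i<k. d i) / k"
      define A where "A = (\<Sum>i<k. (d i - c)\<^sup>2)"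
      define B where "B = (\<Sum>i<k. d i)\<^sup>2 / k"
      have nonneg: "0 \<le> A" "0 \<le> B" by (simp_all add: A_def B_def sum_nonneg)
      have "Q d \<le> \<mu> * A"
        using Q_le[of "\<lambda>i. d i - c"] by (simp add: Q_def dirichlet_form_shift A_def)
      also have "\<dots> \<le> (2 - K) * A" using K nonneg by (intro mult_right_mono) auto
      finally have "Q d + 2 * r * (\<Sum>i<k. d i)\<^sup>2 \<le> (2 - K) * A + 2 * k * r * B"
        using k by (simp add: B_def)
      also have "\<dots> \<le> (2 - K) * A + (2 - K) * B"
        using K nonneg by (intro add_left_mono mult_right_mono) auto
      also have "\<dots> = (2 - K) * (\<Sum>i<k. (d i)\<^sup>2)"
        using sum_squares_shift[OF k, of d] by (simp add: A_def B_def c_def distrib_left)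
      finally show "Q d + 2 * r * (\<Sum>i<k. d i)\<^sup>2 \<le> (2 - K) * (\<Sum>i<k. (d i)\<^sup>2)" .
    qed
  qed
  then have "curvature_function cay x N = (GREATEST K. K \<le> 2 - max \<mu> (2 * k * r))"
    by (simp only: curvature_function_def)
  also have "\<dots> = 2 - max \<mu> (2 * k * r)" by (rule Greatest_equality) simp_all
  finally show ?thesis unfolding \<mu>_def r_def .
qed

text \<open>The upper bound is the comparison with the complete graph. For positivity the test
  vector is \<open>root i\<close>, here the indicator of an endpoint of the edge.\<close>

lemma max_laplacian_eigenvalue_bounds:
  assumes "coxeter_diagram k m i j"
  shows "0 < max_laplacian_eigenvalue k (coxeter_diagram k m)"
    and "max_laplacian_eigenvalue k (coxeter_diagram k m) \<le> k"
proof -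
  have ij: "i < k" "j < k" "i \<noteq> j" using assms by (auto simp: coxeter_diagram_def)
  then have k: "0 < k" by simp
  obtain v where "(\<Sum>i<k. (v i)\<^sup>2) = 1"
    "dirichlet_form k (coxeter_diagram k m) v = max_laplacian_eigenvalue k (coxeter_diagram k m)"
    using diagram_rayleigh(2)[OF k] by blast
  then show "max_laplacian_eigenvalue k (coxeter_diagram k m) \<le> k"
    using dirichlet_form_le[of k "coxeter_diagram k m" v] by simp
  have "0 < (\<Sum>b<k. if coxeter_diagram k m i b then (root i i - root i b)\<^sup>2 / 2 else 0)"
    using assms ij by (intro sum_pos2[of _ j]) (auto simp: root_def)
  then have "0 < dirichlet_form k (coxeter_diagram k m) (root i)"
    unfolding dirichlet_form_def using ij(1) by - (rule sum_pos2[of _ i], auto intro!: sum_nonneg)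
  also have "\<dots> \<le> max_laplacian_eigenvalue k (coxeter_diagram k m) * (\<Sum>l<k. (root i l)\<^sup>2)"
    by (rule diagram_rayleigh(1)[OF k])
  also have "(\<Sum>l<k. (root i l)\<^sup>2) = 1"
    using ij by (simp add: root_def if_distrib[of "\<lambda>x. x\<^sup>2"] cong: if_cong)
  finally show "0 < max_laplacian_eigenvalue k (coxeter_diagram k m)" by simp
qed

end

theorem theorem10p7:
  fixes W :: "('a, 'b) monoid_scheme"
    and k :: nat
    and s :: "nat \<Rightarrow> 'a"
    and m :: "nat \<Rightarrow> nat \<Rightarrow> enat"
  assumes "coxeter_group W k s m"
    and "\<exists>i j. coxeter_diagram k m i j"
  shows "let \<mu> = max_laplacian_eigenvalue k (coxeter_diagram k m);
             N\<^sub>0 = 2 * real k / \<mu>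
         in 0 < \<mu> \<and> \<mu> \<le> real k \<and>
            (\<forall>x\<in>carrier W. \<forall>N::ereal. 0 < N \<longrightarrow>
               curvature_function (cayley_graph W (s ` {..<k})) x N =
                 (if N \<le> ereal N\<^sub>0 then 2 - 2 * real k / real_of_ereal N else 2 - \<mu>))"
proof -
  interpret coxeter W k s m by unfold_locales (rule assms(1))
  define \<mu> where "\<mu> = max_laplacian_eigenvalue k (coxeter_diagram k m)"
  have \<mu>: "0 < \<mu>" "\<mu> \<le> k"
    using max_laplacian_eigenvalue_bounds assms(2) by (auto simp: \<mu>_def)
  have k: "0 < k" using assms(2) by (auto simp: coxeter_diagram_def)
  have "curvature_function cay x N =
      (if N \<le> ereal (2 * real k / \<mu>) then 2 - 2 * real k / real_of_ereal N else 2 - \<mu>)"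
    if x: "x \<in> carrier W" and N: "0 < N" for x N
  proof (cases N)
    case (real n)
    then have "0 < n" using N by simp
    then have inv: "real_of_ereal (1 / N) = 1 / n" by (simp add: real one_ereal_def)
    have "curvature_function cay x N = 2 - max \<mu> (2 * k / n)"
      using curvature_function_cayley[OF x k, of N] \<open>0 < n\<close>
      unfolding inv \<mu>_def[symmetric] by simp
    \<comment> \<open>The threshold is where the two arguments of \<open>max\<close> cross.\<close>
    moreover have "n \<le> 2 * real k / \<mu> \<longleftrightarrow> \<mu> \<le> 2 * real k / n"
      using \<open>0 < n\<close> \<mu>(1) by (simp add: field_simps)
    ultimately show ?thesis by (simp add: real max_def)
  next
    \<comment> \<open>The dimension term is zero here, and \<open>\<mu>\<close> is positive, so the
      maximum is \<open>\<mu>\<close>.\<close>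
    case PInf
    then show ?thesis
      using curvature_function_cayley[OF x k, of N] \<mu>(1) by (simp add: \<mu>_def[symmetric])
  qed (use N in simp)
  then show ?thesis using \<mu> by (simp add: Let_def \<mu>_def)
qed

end
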